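(* Let $G$ be a finite group acting linearly on $\mathbb{R}^d$, let $v\in\mathbb{R}^d$, and let $P(G,v)$ be the orbit polytope of $v$. Then $P(G,v)$ is affinely $G$-equivalent to a representation polytope of $G$ if and only if there is an affine symmetry $\alpha$ of $P(G,v)$ such that $\alpha(gv)=g^{-1}v$ for all $g\in G$.
   Context: If the finite group $G$ acts linearly on a real vector space $V$ (via a representation) and $v\in V$, the orbit polytope is $P(G,v)=\operatorname{conv}\{gv\mid g\in G\}$. An affine symmetry of a polytope $P$ is a bijection of $P$ that is the restriction of an affine map of the ambient space. A representation polytope of $G$ is a polytope $P(D)=\operatorname{conv}\{D(g)\mid g\in G\}\subset\mathbb{R}^{n\times n}$, where $D\colon G\to\mathrm{GL}(n,\mathbb{R})$ is a representation of $G$ (for some $n$); it is the orbit polytope $P(G,I)$ of the identity matrix $I$, where $g\in G$ acts on $\mathbb{R}^{n\times n}$ by left multiplication with $D(g)$. Two orbit polytopes $P(G,v)\subset V$ and $P(G,w)\subset W$ of the same group $G$ are affinely $G$-equivalent if there is an affine isomorphism $\alpha\colon P(G,v)\to P(G,w)$ with $\alpha(gx)=g\alpha(x)$ for all $x\in P(G,v)$ and $g\in G$. *)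

theory Defs
  imports "HOL-Analysis.Analysis" "HOL-Algebra.Group_Action" "Jordan_Normal_Form.Matrix"
begin

definition linear_action ::
  "('g, 'b) monoid_scheme \<Rightarrow> ('g \<Rightarrow> 'v::real_vector \<Rightarrow> 'v) \<Rightarrow> bool" where
  "linear_action G \<phi> \<longleftrightarrow> group_action G UNIV \<phi> \<and> (\<forall>g\<in>carrier G. linear (\<phi> g))"

definition orbit_polytope ::
  "('g, 'b) monoid_scheme \<Rightarrow> ('g \<Rightarrow> 'v::real_vector \<Rightarrow> 'v) \<Rightarrow> 'v \<Rightarrow> 'v set" where
  "orbit_polytope G \<phi> v = convex hull {\<phi> g v | g. g \<in> carrier G}"

definition affine_map :: "('v::real_vector \<Rightarrow> 'w::real_vector) \<Rightarrow> bool" where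
  "affine_map f \<longleftrightarrow>
     (\<forall>x y u w. u + w = 1 \<longrightarrow> f (u *\<^sub>R x + w *\<^sub>R y) = u *\<^sub>R f x + w *\<^sub>R f y)"

definition affine_symmetry :: "'v::real_vector set \<Rightarrow> ('v \<Rightarrow> 'v) \<Rightarrow> bool" where
  "affine_symmetry P \<alpha> \<longleftrightarrow>
     bij_betw \<alpha> P P \<and> (\<exists>f. affine_map f \<and> (\<forall>x\<in>P. \<alpha> x = f x))"

text \<open>
  The size of a representation must be a quantifiable natural number, so its matrices have
  type \<^typ>\<open>real mat\<close>. That type, comprising all sizes, is not a \<^class>\<open>real_vector\<close>, whence
  convexity and affinity are restated for it, in the form of \<^const>\<open>convex\<close> and
  \<^const>\<open>affine_map\<close>.
\<close>

definition GL_real :: "nat \<Rightarrow> real mat monoid" where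
  "GL_real n = units_of (ring_mat TYPE(real) n ())"

definition is_representation ::
  "('g, 'b) monoid_scheme \<Rightarrow> nat \<Rightarrow> ('g \<Rightarrow> real mat) \<Rightarrow> bool" where
  "is_representation G n D \<longleftrightarrow> D \<in> hom G (GL_real n)"

definition mat_convex :: "real mat set \<Rightarrow> bool" where
  "mat_convex S \<longleftrightarrow>
     (\<forall>A\<in>S. \<forall>B\<in>S. \<forall>u\<ge>0. \<forall>w\<ge>0. u + w = 1 \<longrightarrow> u \<cdot>\<^sub>m A + w \<cdot>\<^sub>m B \<in> S)"

definition representation_polytope ::
  "('g, 'b) monoid_scheme \<Rightarrow> ('g \<Rightarrow> real mat) \<Rightarrow> real mat set" where
  "representation_polytope G D = mat_convex hull {D g | g. g \<in> carrier G}"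

definition mat_affine_map :: "nat \<Rightarrow> ('v::real_vector \<Rightarrow> real mat) \<Rightarrow> bool" where
  "mat_affine_map n f \<longleftrightarrow>
     (\<forall>x. f x \<in> carrier_mat n n) \<and>
     (\<forall>x y u w. u + w = 1 \<longrightarrow> f (u *\<^sub>R x + w *\<^sub>R y) = u \<cdot>\<^sub>m f x + w \<cdot>\<^sub>m f y)"

text \<open>
  Affine \<open>G\<close>-equivalence of the orbit polytope of \<open>v\<close> with the representation polytope of \<open>D\<close>,
  that is, with the orbit polytope of the identity matrix when \<open>g\<close> acts on matrices by left
  multiplication with \<open>D g\<close>. An affine map that is injective on a convex set is injective on
  its affine hull, so the inverse of \<open>\<alpha>\<close> is automatically the restriction of an affine map.
\<close>

definition affinely_equivalent_to_rep_polytope ::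
  "('g, 'b) monoid_scheme \<Rightarrow> ('g \<Rightarrow> 'v::real_vector \<Rightarrow> 'v) \<Rightarrow> 'v \<Rightarrow> nat \<Rightarrow> ('g \<Rightarrow> real mat) \<Rightarrow> bool" where
  "affinely_equivalent_to_rep_polytope G \<phi> v n D \<longleftrightarrow>
     (\<exists>\<alpha>. bij_betw \<alpha> (orbit_polytope G \<phi> v) (representation_polytope G D) \<and>
          (\<exists>f. mat_affine_map n f \<and> (\<forall>x\<in>orbit_polytope G \<phi> v. \<alpha> x = f x)) \<and>
          (\<forall>g\<in>carrier G. \<forall>x\<in>orbit_polytope G \<phi> v. \<alpha> (\<phi> g x) = D g * \<alpha> x))"

end

(*
  There is an affine map sending gv to g^-1 v if and only if every affine relation
  sum c_g gv = 0, sum c_g = 0, also holds with g^-1 in place of g. For a representation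
  polytope it does: with respect to an invariant inner product, D(g^-1) is the adjoint of D(g).
  An equivalence transfers the property to P(G,v), because it sends gv to D(g) A with A
  invertible. Conversely, given the symmetry, the affine relations among the points gv are also
  relations among the operators g on the span of the orbit.
*)
theory Submission
  imports Defs "Jordan_Normal_Form.Determinant"
begin

no_notation scalar_prod (infix "\<bullet>" 70)

section \<open>Affine maps, affine relations and extension from finite families\<close>

text \<open>Weights \<open>r\<close> and \<open>1 - r\<close> at \<open>x\<close> and
  \<open>0\<close> give homogeneity for every real \<open>r\<close>; additivity follows because
  \<open>x + y\<close> is twice a midpoint.\<close>

lemma affine_map_imp_linear:
  assumes "affine_map f"
  shows "linear (\<lambda>x. f x - f 0)"
proof -
  have comb: "f (u *\<^sub>R x + w *\<^sub>R y) = u *\<^sub>R f x + w *\<^sub>R f y" if "u + w = 1" for u w x y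
    using assms that unfolding affine_map_def by blast
  have scale: "f (r *\<^sub>R x) - f 0 = r *\<^sub>R (f x - f 0)" for r x
    using comb[of r "1 - r" x 0] by (simp add: algebra_simps)
  have "f (x + y) - f 0 = (f x - f 0) + (f y - f 0)" for x y
  proof -
    have "f (x + y) - f 0 = f (2 *\<^sub>R ((1/2) *\<^sub>R x + (1/2) *\<^sub>R y)) - f 0"
      by (simp add: scaleR_right_distrib)
    also have "\<dots> = 2 *\<^sub>R ((1/2) *\<^sub>R f x + (1/2) *\<^sub>R f y - f 0)"
      unfolding scale by (subst comb) auto
    also have "\<dots> = (f x - f 0) + (f y - f 0)"
      by (simp add: algebra_simps scaleR_2)
    finally show ?thesis .
  qed
  then show ?thesis
    using scale by (intro linearI)
qed

text \<open>The terms in \<open>f 0\<close> admit weights of any total. They cancel for total 1; for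
  total 0 the right-hand side vanishes as soon as the combination of the points does.\<close>

lemma affine_map_sum:
  assumes "affine_map f"
  shows "(\<Sum>i\<in>I. c i *\<^sub>R f (p i)) = f (\<Sum>i\<in>I. c i *\<^sub>R p i) - f 0 + sum c I *\<^sub>R f 0"
proof -
  interpret linear "\<lambda>x. f x - f 0"
    using assms by (rule affine_map_imp_linear)
  have "f (\<Sum>i\<in>I. c i *\<^sub>R p i) - f 0 = (\<Sum>i\<in>I. c i *\<^sub>R (f (p i) - f 0))"
    by (simp add: sum scale)
  then show ?thesis
    by (simp add: scaleR_right_diff_distrib sum_subtractf scaleR_left.sum)
qed

lemma affine_map_relation:
  assumes "affine_map f" "sum c I = 0" "(\<Sum>i\<in>I. c i *\<^sub>R p i) = 0"
  shows "(\<Sum>i\<in>I. c i *\<^sub>R f (p i)) = 0"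
  using affine_map_sum[OF assms(1), of c p I] assms(2,3) by simp

text \<open>The set on which two affine maps agree is convex, so it contains the hull once it
  contains \<open>S\<close>.\<close>

lemma affine_map_eq_on_hull:
  assumes "affine_map f" "affine_map g" "\<And>x. x \<in> S \<Longrightarrow> f x = g x" "x \<in> convex hull S"
  shows "f x = g x"
proof -
  have "convex {x. f x = g x}"
    using assms(1,2) unfolding affine_map_def convex_def by simp
  then have "convex hull S \<subseteq> {x. f x = g x}"
    using assms(3) by (intro hull_minimal) auto
  then show ?thesis
    using assms(4) by blast
qed

lemma affine_map_hull_subset:
  assumes "affine_map f" "f ` S \<subseteq> convex hull T" "x \<in> convex hull S"
  shows "f x \<in> convex hull T"
proof -
  have "convex (convex hull T)"
    by simp
  then have "convex {x. f x \<in> convex hull T}"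
    using assms(1) unfolding affine_map_def convex_def by simp
  then have "convex hull S \<subseteq> {x. f x \<in> convex hull T}"
    using assms(2) by (intro hull_minimal) auto
  then show ?thesis
    using assms(3) by blast
qed

lemma linear_imp_affine_map: "linear f \<Longrightarrow> affine_map f"
  by (simp add: affine_map_def linear_add linear_scale)

lemma affine_map_compose: "affine_map f \<Longrightarrow> affine_map g \<Longrightarrow> affine_map (\<lambda>x. f (g x))"
  by (simp add: affine_map_def)

text \<open>\<open>L\<close> is prescribed on a basis chosen among the \<open>p i\<close>. Expanding
  any \<open>p i\<close> in that basis is a linear relation, and its transfer to \<open>q\<close>
  forces \<open>L (p i) = q i\<close>.\<close>

lemma linear_extension_of_family:
  fixes p :: "'i \<Rightarrow> 'v::real_vector" and q :: "'i \<Rightarrow> 'w::real_vector"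
  assumes "finite I"
    and rel: "\<And>c. (\<Sum>i\<in>I. c i *\<^sub>R p i) = 0 \<Longrightarrow> (\<Sum>i\<in>I. c i *\<^sub>R q i) = 0"
  shows "\<exists>L. linear L \<and> (\<forall>i\<in>I. L (p i) = q i)"
proof -
  obtain B where B: "B \<subseteq> p ` I" "independent B" "p ` I \<subseteq> span B"
    using real_vector.maximal_independent_subset by blast
  \<comment> \<open>\<open>p\<close> may repeat values, so a single index is selected for each basis
    vector.\<close>
  obtain J where J: "J \<subseteq> I" "inj_on p J" "p ` J = B"
    using B(1) by (metis subset_image_inj)
  obtain L where L: "linear L" "\<And>b. b \<in> B \<Longrightarrow> L b = q (inv_into J p b)"
    using linear_independent_extend[OF B(2), of "\<lambda>b. q (inv_into J p b)"] by blast
  have LJ: "L (p j) = q j" if "j \<in> J" for j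
    using L(2)[of "p j"] that J by auto
  have "L (p i) = q i" if i: "i \<in> I" for i
  proof -
    have finJ: "finite J"
      using J(1) \<open>finite I\<close> finite_subset by blast
    then have "finite B"
      using J(3) by blast
    moreover have "p i \<in> span B"
      using B(3) i by blast
    ultimately obtain u where "p i = (\<Sum>b\<in>B. u b *\<^sub>R b)"
      using span_finite[of B] by auto
    then have pi: "p i = (\<Sum>j\<in>J. u (p j) *\<^sub>R p j)"
      unfolding J(3)[symmetric] using J(2) by (simp add: sum.reindex)
    \<comment> \<open>The expansion of \<open>p i\<close> as one coefficient family on
      \<open>I\<close>. The two separate conditionals also cover \<open>i \<in> J\<close>. The next
      fact is polymorphic in \<open>r\<close>, for use with both \<open>p\<close> and
      \<open>q\<close>.\<close>
    define c where "c k = (if k = i then 1 else 0) - (if k \<in> J then u (p k) else 0)" for k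
    have c: "(\<Sum>k\<in>I. c k *\<^sub>R r k) = r i - (\<Sum>j\<in>J. u (p j) *\<^sub>R r j)" for r :: "'i \<Rightarrow> 'x::real_vector"
    proof -
      have "(\<Sum>k\<in>I. (if k \<in> J then u (p k) else 0) *\<^sub>R r k) = (\<Sum>j\<in>J. u (p j) *\<^sub>R r j)"
        using J(1) \<open>finite I\<close> by (intro sum.mono_neutral_cong_right) auto
      moreover have "(\<Sum>k\<in>I. (if k = i then 1 else 0) *\<^sub>R r k) = r i"
        using i \<open>finite I\<close> by (simp add: if_distrib[of "\<lambda>a. a *\<^sub>R _"] cong: if_cong)
      ultimately show ?thesis
        by (simp add: c_def scaleR_left_diff_distrib sum_subtractf)
    qed
    have "q i = (\<Sum>j\<in>J. u (p j) *\<^sub>R q j)"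
      using rel[of c] pi by (simp add: c)
    also have "\<dots> = L (p i)"
      by (subst pi) (simp add: linear_sum[OF L(1)] linear_scale[OF L(1)] LJ)
    finally show ?thesis
      by simp
  qed
  then show ?thesis
    using L(1) by blast
qed

text \<open>Homogenization: a linear relation among the lifted points \<open>(p i, 1)\<close> is an
  affine relation among the \<open>p i\<close>, and a linear map restricted to height 1 is
  affine.\<close>

lemma affine_extension_of_family:
  fixes p :: "'i \<Rightarrow> 'v::real_vector" and q :: "'i \<Rightarrow> 'w::real_vector"
  assumes "finite I"
    and rel: "\<And>c. sum c I = 0 \<Longrightarrow> (\<Sum>i\<in>I. c i *\<^sub>R p i) = 0 \<Longrightarrow> (\<Sum>i\<in>I. c i *\<^sub>R q i) = 0"
  shows "\<exists>f. affine_map f \<and> (\<forall>i\<in>I. f (p i) = q i)"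
proof -
  have "\<exists>L. linear L \<and> (\<forall>i\<in>I. L (p i, 1::real) = q i)"
  proof (rule linear_extension_of_family[OF \<open>finite I\<close>])
    fix c assume "(\<Sum>i\<in>I. c i *\<^sub>R (p i, 1::real)) = 0"
    then have "(\<Sum>i\<in>I. c i *\<^sub>R p i) = 0 \<and> sum c I = 0"
      by (simp add: prod_eq_iff fst_sum snd_sum)
    then show "(\<Sum>i\<in>I. c i *\<^sub>R q i) = 0"
      using rel by blast
  qed
  then obtain L where L: "linear L" "\<And>i. i \<in> I \<Longrightarrow> L (p i, 1::real) = q i"
    by blast
  have "affine_map (\<lambda>x. L (x, 1))"
    unfolding affine_map_def
  proof (intro allI impI)
    fix x y :: 'v and u w :: real assume "u + w = 1"
    then have "(u *\<^sub>R x + w *\<^sub>R y, 1) = u *\<^sub>R (x, 1::real) + w *\<^sub>R (y, 1)"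
      by simp
    then show "L (u *\<^sub>R x + w *\<^sub>R y, 1) = u *\<^sub>R L (x, 1) + w *\<^sub>R L (y, 1)"
      using L(1) by (simp add: linear_add linear_scale del: scaleR_Pair add_Pair)
  qed
  then show ?thesis
    using L(2) by blast
qed

section \<open>Matrix representations and relations under inversion\<close>

lemma is_representationD:
  assumes "group G" "is_representation G n D"
  shows "g \<in> carrier G \<Longrightarrow> D g \<in> carrier_mat n n"
    and "g \<in> carrier G \<Longrightarrow> h \<in> carrier G \<Longrightarrow> D (g \<otimes>\<^bsub>G\<^esub> h) = D g * D h"
    and "D \<one>\<^bsub>G\<^esub> = 1\<^sub>m n"
proof -
  interpret G: group G by fact
  interpret R: semiring "ring_mat TYPE(real) n ()"
    by (rule semiring_mat)
  have hom: "D \<in> hom G (units_of (ring_mat TYPE(real) n ()))"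
    using assms(2) by (simp add: is_representation_def GL_real_def)
  then show "g \<in> carrier G \<Longrightarrow> D g \<in> carrier_mat n n" for g
    by (auto simp: hom_def units_of_def Units_def ring_mat_simps dest!: funcset_mem)
  show "g \<in> carrier G \<Longrightarrow> h \<in> carrier G \<Longrightarrow> D (g \<otimes>\<^bsub>G\<^esub> h) = D g * D h" for g h
    using hom by (auto simp: hom_def units_of_def ring_mat_simps)
  show "D \<one>\<^bsub>G\<^esub> = 1\<^sub>m n"
    using hom_one[OF hom G.group_axioms R.units_group]
    by (simp add: units_of_def ring_mat_simps)
qed

text \<open>Each \<open>D g\<close> is a unit because multiplicativity and the value at the identity
  make \<open>D (inv g)\<close> its two-sided inverse.\<close>

lemma is_representationI:
  assumes "group G" "\<And>g. g \<in> carrier G \<Longrightarrow> D g \<in> carrier_mat n n"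
    and "\<And>g h. g \<in> carrier G \<Longrightarrow> h \<in> carrier G \<Longrightarrow> D (g \<otimes>\<^bsub>G\<^esub> h) = D g * D h"
    and "D \<one>\<^bsub>G\<^esub> = 1\<^sub>m n"
  shows "is_representation G n D"
proof -
  interpret G: group G by fact
  have "D g \<in> Units (ring_mat TYPE(real) n ())" if "g \<in> carrier G" for g
  proof -
    have "D (inv\<^bsub>G\<^esub> g) * D g = 1\<^sub>m n" "D g * D (inv\<^bsub>G\<^esub> g) = 1\<^sub>m n"
      using assms(3,4) that by (metis G.inv_closed G.l_inv G.r_inv)+
    then show ?thesis
      using assms(2) that by (auto simp: Units_def ring_mat_simps)
  qed
  then show ?thesis
    using assms(3) by (auto simp: is_representation_def GL_real_def hom_def units_of_def ring_mat_simps)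
qed

text \<open>
  With \<open>a g = \<Sum>h. c h * D (g h\<^sup>-\<^sup>1) $$ (i, j)\<close>, the sum of the squares \<open>(a g)\<^sup>2\<close> becomes, after
  substituting \<open>g h\<close> for \<open>g\<close>, a combination of the sums \<open>\<Sum>h. c h * a (g h)\<close>, which vanish by
  the assumed relation. Hence \<open>a = 0\<close>.
\<close>

lemma representation_inverse_relation:
  assumes "group G" "finite (carrier G)" "is_representation G n D"
    and rel: "\<And>i j. i < n \<Longrightarrow> j < n \<Longrightarrow> (\<Sum>g\<in>carrier G. c g * D g $$ (i, j)) = 0"
    and ij: "i < n" "j < n"
  shows "(\<Sum>g\<in>carrier G. c g * D (inv\<^bsub>G\<^esub> g) $$ (i, j)) = 0"
proof -
  interpret G: group G by fact
  note D = is_representationD[OF assms(1,3)]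
  have mult: "D (g \<otimes>\<^bsub>G\<^esub> h) $$ (k, l) = (\<Sum>m<n. D g $$ (k, m) * D h $$ (m, l))"
    if "g \<in> carrier G" "h \<in> carrier G" "k < n" "l < n" for g h k l
    using that D(1)[of g] D(1)[of h]
    by (auto simp: D(2) scalar_prod_def atLeast0LessThan intro!: sum.cong)
  \<comment> \<open>For \<open>g\<close> in the group, \<open>a g\<close> is the
    \<open>(i, j)\<close> entry of \<open>D g\<close> times the sum of all \<open>c h\<close> times
    \<open>D (inv h)\<close>; the claim is that \<open>a\<close> vanishes at the identity.\<close>
  define a where "a g = (\<Sum>h\<in>carrier G. c h * D (g \<otimes>\<^bsub>G\<^esub> inv\<^bsub>G\<^esub> h) $$ (i, j))" for g
  have mult3: "D (g \<otimes>\<^bsub>G\<^esub> h \<otimes>\<^bsub>G\<^esub> inv\<^bsub>G\<^esub> k) $$ (i, j)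
      = (\<Sum>m<n. \<Sum>l<n. D g $$ (i, l) * D h $$ (l, m) * D (inv\<^bsub>G\<^esub> k) $$ (m, j))"
    if "g \<in> carrier G" "h \<in> carrier G" "k \<in> carrier G" for g h k
    using that ij by (simp add: mult sum_distrib_right)
  \<comment> \<open>The sum is the \<open>(i, j)\<close> entry of a product
    \<open>D g * X * Y\<close>, where \<open>X\<close> is the sum of all \<open>c h\<close> times
    \<open>D h\<close> and \<open>Y\<close> the sum of all \<open>c k\<close> times
    \<open>D (inv k)\<close>. By \<open>rel\<close>, \<open>X\<close> is zero.\<close>
  have translate: "(\<Sum>h\<in>carrier G. c h * a (g \<otimes>\<^bsub>G\<^esub> h)) = 0" if g: "g \<in> carrier G" for g
  proof -
    have "(\<Sum>h\<in>carrier G. c h * a (g \<otimes>\<^bsub>G\<^esub> h))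
      = (\<Sum>h\<in>carrier G. \<Sum>k\<in>carrier G. c h * (c k * (\<Sum>m<n. \<Sum>l<n. D g $$ (i, l) * D h $$ (l, m) * D (inv\<^bsub>G\<^esub> k) $$ (m, j))))"
      by (intro sum.cong refl) (simp add: a_def sum_distrib_left mult3 g)
    also have "\<dots> = (\<Sum>k\<in>carrier G. \<Sum>h\<in>carrier G. \<Sum>m<n. \<Sum>l<n. c k * D g $$ (i, l) * D (inv\<^bsub>G\<^esub> k) $$ (m, j) * (c h * D h $$ (l, m)))"
      by (subst sum.swap) (simp add: sum_distrib_left mult_ac)
    also have "\<dots> = (\<Sum>k\<in>carrier G. \<Sum>m<n. \<Sum>l<n. c k * D g $$ (i, l) * D (inv\<^bsub>G\<^esub> k) $$ (m, j) * (\<Sum>h\<in>carrier G. c h * D h $$ (l, m)))"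
      by (rule sum.cong[OF refl], subst sum.swap, rule sum.cong[OF refl], subst sum.swap)
        (simp add: sum_distrib_left)
    also have "\<dots> = 0"
      by (simp add: rel)
    finally show ?thesis .
  qed
  \<comment> \<open>Summing products of functions over the group is a translation-invariant inner
    product; it takes over the role of an invariant inner product on the space of the
    representation.\<close>
  have "(\<Sum>g\<in>carrier G. (a g)\<^sup>2) = (\<Sum>g\<in>carrier G. \<Sum>h\<in>carrier G. c h * D (g \<otimes>\<^bsub>G\<^esub> inv\<^bsub>G\<^esub> h) $$ (i, j) * a g)"
    by (intro sum.cong refl) (simp add: power2_eq_square, simp add: a_def sum_distrib_right)
  also have "\<dots> = (\<Sum>h\<in>carrier G. \<Sum>g\<in>carrier G. c h * D (g \<otimes>\<^bsub>G\<^esub> inv\<^bsub>G\<^esub> h) $$ (i, j) * a g)"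
    by (rule sum.swap)
  also have "\<dots> = (\<Sum>h\<in>carrier G. \<Sum>g\<in>carrier G. c h * D g $$ (i, j) * a (g \<otimes>\<^bsub>G\<^esub> h))"
  proof (rule sum.cong[OF refl])
    fix h assume h: "h \<in> carrier G"
    show "(\<Sum>g\<in>carrier G. c h * D (g \<otimes>\<^bsub>G\<^esub> inv\<^bsub>G\<^esub> h) $$ (i, j) * a g)
      = (\<Sum>g\<in>carrier G. c h * D g $$ (i, j) * a (g \<otimes>\<^bsub>G\<^esub> h))"
      using h by (intro sum.reindex_bij_witness[where i = "\<lambda>g. g \<otimes>\<^bsub>G\<^esub> h" and j = "\<lambda>g. g \<otimes>\<^bsub>G\<^esub> inv\<^bsub>G\<^esub> h"])
        (auto simp: G.m_assoc)
  qed
  also have "\<dots> = (\<Sum>g\<in>carrier G. D g $$ (i, j) * (\<Sum>h\<in>carrier G. c h * a (g \<otimes>\<^bsub>G\<^esub> h)))"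
    by (subst sum.swap) (simp add: sum_distrib_left mult_ac)
  also have "\<dots> = 0"
    by (simp add: translate)
  finally have "a \<one>\<^bsub>G\<^esub> = 0"
    using assms(2) by (subst (asm) sum_nonneg_eq_0_iff) auto
  then show ?thesis
    by (simp add: a_def cong: sum.cong)
qed

section \<open>Affine relations detected by jointly injective affine functions\<close>

text \<open>
  The points with barycentric weights \<open>1 / N\<close> and \<open>1 / N + \<epsilon> c i\<close> lie in the hull for small
  \<open>\<epsilon> > 0\<close> and have the same image.
\<close>

lemma relation_of_injective_affine_family:
  fixes F :: "'k \<Rightarrow> 'v::real_vector \<Rightarrow> real"
  assumes "finite I" and aff: "\<And>k. k \<in> K \<Longrightarrow> affine_map (F k)"
    and inj: "\<And>x y. x \<in> convex hull (p ` I) \<Longrightarrow> y \<in> convex hull (p ` I) \<Longrightarrow>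
      (\<And>k. k \<in> K \<Longrightarrow> F k x = F k y) \<Longrightarrow> x = y"
    and c: "sum c I = 0" and rel: "\<And>k. k \<in> K \<Longrightarrow> (\<Sum>i\<in>I. c i * F k (p i)) = 0"
  shows "(\<Sum>i\<in>I. c i *\<^sub>R p i) = 0"
proof (cases "I = {}")
  case False
  define N where "N = real (card I)"
  \<comment> \<open>\<open>S\<close> bounds every \<open>\<bar>c i\<bar>\<close>, and the summand 1
    keeps it positive even if \<open>c\<close> vanishes. Thus \<epsilon> =
    \<open>1 / (N * S)\<close> leaves the weights \<open>t\<close> nonnegative.\<close>
  define S where "S = 1 + (\<Sum>i\<in>I. \<bar>c i\<bar>)"
  have N: "N > 0"
    using False \<open>finite I\<close> by (simp add: N_def card_gt_0_iff)
  have S: "S > 0" and cS: "\<bar>c i\<bar> \<le> S" if "i \<in> I" for i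
    using member_le_sum[OF that, of "\<lambda>i. \<bar>c i\<bar>"] \<open>finite I\<close> by (auto simp: S_def)
  have S: "S > 0"
    using S False by blast
  define t where "t i = 1 / N + c i / (N * S)" for i
  have t_nonneg: "t i \<ge> 0" if "i \<in> I" for i
  proof -
    have "t i = (S + c i) / (N * S)"
      using N S by (simp add: t_def field_simps)
    then show ?thesis
      using N S cS[OF that] by simp
  qed
  have sum_N: "(\<Sum>i\<in>I. 1 / N) = 1"
    using N by (simp add: N_def)
  have sum_t: "sum t I = 1"
    using c sum_N by (simp add: t_def sum.distrib flip: sum_divide_distrib)
  define x y where "x = (\<Sum>i\<in>I. (1 / N) *\<^sub>R p i)" and "y = (\<Sum>i\<in>I. t i *\<^sub>R p i)"
  have hull: "(\<Sum>i\<in>I. a i *\<^sub>R p i) \<in> convex hull (p ` I)"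
    if "sum a I = 1" "\<And>i. i \<in> I \<Longrightarrow> a i \<ge> 0" for a
    using that \<open>finite I\<close> by (intro convex_sum) (auto intro: hull_inc)
  have "x = y"
  proof (rule inj)
    show "x \<in> convex hull (p ` I)" "y \<in> convex hull (p ` I)"
      unfolding x_def y_def using sum_N sum_t t_nonneg N by (auto intro!: hull)
    fix k assume k: "k \<in> K"
    have "F k y = (\<Sum>i\<in>I. t i * F k (p i))"
      using affine_map_sum[OF aff[OF k], of t p I] sum_t by (simp add: y_def)
    also have "\<dots> = (\<Sum>i\<in>I. 1 / N * F k (p i)) + (\<Sum>i\<in>I. c i * F k (p i)) / (N * S)"
      by (simp add: t_def distrib_right sum.distrib sum_divide_distrib)
    also have "\<dots> = F k x"
      using affine_map_sum[OF aff[OF k], of "\<lambda>_. 1 / N" p I] sum_N rel[OF k] by (simp add: x_def)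
    finally show "F k x = F k y" ..
  qed
  moreover have "y = x + (1 / (N * S)) *\<^sub>R (\<Sum>i\<in>I. c i *\<^sub>R p i)"
    by (simp add: x_def y_def t_def scaleR_left_distrib sum.distrib scaleR_sum_right)
  ultimately show ?thesis
    using N S by simp
qed simp

section \<open>Orbit polytopes and matrix-valued affine maps\<close>

lemma linear_actionD:
  assumes "linear_action G \<phi>"
  shows "g \<in> carrier G \<Longrightarrow> linear (\<phi> g)"
    and "g \<in> carrier G \<Longrightarrow> h \<in> carrier G \<Longrightarrow> \<phi> (g \<otimes>\<^bsub>G\<^esub> h) x = \<phi> g (\<phi> h x)"
    and "\<phi> \<one>\<^bsub>G\<^esub> x = x"
proof -
  interpret group_action G UNIV \<phi>
    using assms by (simp add: linear_action_def)
  show "g \<in> carrier G \<Longrightarrow> linear (\<phi> g)"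
    using assms by (simp add: linear_action_def)
  show "g \<in> carrier G \<Longrightarrow> h \<in> carrier G \<Longrightarrow> \<phi> (g \<otimes>\<^bsub>G\<^esub> h) x = \<phi> g (\<phi> h x)"
    by (simp add: composition_rule)
  show "\<phi> \<one>\<^bsub>G\<^esub> x = x"
    using id_eq_one by (metis UNIV_I restrict_apply)
qed

lemma orbit_polytope_altdef: "orbit_polytope G \<phi> v = convex hull ((\<lambda>g. \<phi> g v) ` carrier G)"
  by (simp add: orbit_polytope_def Setcompr_eq_image)

lemma orbit_in_orbit_polytope: "g \<in> carrier G \<Longrightarrow> \<phi> g v \<in> orbit_polytope G \<phi> v"
  by (auto simp: orbit_polytope_altdef intro: hull_inc)

lemma orbit_polytope_invariant:
  assumes "group G" "linear_action G \<phi>" "g \<in> carrier G" "x \<in> orbit_polytope G \<phi> v"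
  shows "\<phi> g x \<in> orbit_polytope G \<phi> v"
proof -
  interpret G: group G by fact
  note \<phi> = linear_actionD[OF assms(2)]
  have "\<phi> g ` (\<lambda>g. \<phi> g v) ` carrier G \<subseteq> convex hull ((\<lambda>g. \<phi> g v) ` carrier G)"
    using assms(3) by (auto simp flip: \<phi>(2) intro!: hull_inc)
  then show ?thesis
    using assms(4) affine_map_hull_subset[OF linear_imp_affine_map[OF \<phi>(1)[OF assms(3)]]]
    unfolding orbit_polytope_altdef by blast
qed

text \<open>Matrix-valued affine maps are handled entrywise, so that the facts on affine maps
  between real vector spaces apply to them.\<close>

lemma mat_affine_map_entry:
  assumes "mat_affine_map n f" "i < n" "j < n"
  shows "affine_map (\<lambda>x. f x $$ (i, j))"
proof -
  have "dim_row (f x) = n" "dim_col (f x) = n" for x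
    using assms(1) by (auto simp: mat_affine_map_def)
  then show ?thesis
    using assms by (simp add: affine_map_def mat_affine_map_def)
qed

lemma mat_convex_mat_convex_hull: "mat_convex (mat_convex hull S)"
  unfolding hull_def mat_convex_def by blast

text \<open>Carries a property of matrices from the orbit to its convex hull: the points whose image
  has the property form a convex set.\<close>

lemma convex_mat_affine_vimage:
  assumes "mat_affine_map n f" "mat_convex S"
  shows "convex {x. f x \<in> S}"
  using assms unfolding convex_def mat_affine_map_def mat_convex_def by auto

section \<open>From an equivalence to the inverting symmetry\<close>

text \<open>With \<open>A = f v\<close>, an affine relation passes from the points
  \<open>\<phi> g v\<close> to \<open>D g * A\<close>, then to \<open>D g\<close> by cancelling
  \<open>A\<close>, to \<open>D (inv g)\<close>, to \<open>D (inv g) * A\<close>, and back to the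
  points \<open>\<phi> (inv g) v\<close> because \<open>f\<close> is injective on the
  polytope.\<close>

lemma inverse_symmetry_if_equivalent_to_rep_polytope:
  fixes \<phi> :: "'g \<Rightarrow> 'v::real_vector \<Rightarrow> 'v"
  assumes "group G" "finite (carrier G)" "linear_action G \<phi>" "is_representation G n D"
    and equiv: "affinely_equivalent_to_rep_polytope G \<phi> v n D"
  shows "\<exists>\<alpha>. affine_symmetry (orbit_polytope G \<phi> v) \<alpha> \<and>
    (\<forall>g\<in>carrier G. \<alpha> (\<phi> g v) = \<phi> (inv\<^bsub>G\<^esub> g) v)"
proof -
  interpret G: group G by fact
  note \<phi> = linear_actionD[OF assms(3)]
  note D = is_representationD[OF assms(1,4)]
  let ?P = "orbit_polytope G \<phi> v"
  obtain \<alpha> f where bij: "bij_betw \<alpha> ?P (representation_polytope G D)"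
    and f: "mat_affine_map n f" and \<alpha>f: "\<And>x. x \<in> ?P \<Longrightarrow> \<alpha> x = f x"
    and equi: "\<And>g x. g \<in> carrier G \<Longrightarrow> x \<in> ?P \<Longrightarrow> \<alpha> (\<phi> g x) = D g * \<alpha> x"
    using equiv unfolding affinely_equivalent_to_rep_polytope_def by blast
  define A where "A = f v"
  have vP: "v \<in> ?P"
    using orbit_in_orbit_polytope[OF G.one_closed, of \<phi> v] by (simp add: \<phi>(3))
  have fC: "f x \<in> carrier_mat n n" for x
    using f by (simp add: mat_affine_map_def)
  then have A: "A \<in> carrier_mat n n"
    by (simp add: A_def)
  have forbit: "f (\<phi> g v) = D g * A" if "g \<in> carrier G" for g
    using equi[OF that vP] \<alpha>f[OF vP] \<alpha>f[OF orbit_in_orbit_polytope[OF that]] by (simp add: A_def)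
  have inj: "x = y" if "x \<in> ?P" "y \<in> ?P" "\<And>i j. i < n \<Longrightarrow> j < n \<Longrightarrow> f x $$ (i, j) = f y $$ (i, j)" for x y
  proof -
    have "f x = f y"
      using that(3) carrier_matD[OF fC[of x]] carrier_matD[OF fC[of y]] by (intro eq_matI) auto
    then show ?thesis
      using bij that(1,2) \<alpha>f by (metis bij_betw_imp_inj_on inj_onD)
  qed
  \<comment> \<open>The matrices \<open>T * A\<close> form a convex set containing the image of the
    orbit, hence the image of the polytope. Applied to the point sent to the identity matrix, this
    makes \<open>A\<close> invertible.\<close>
  have multiple: "\<exists>T\<in>carrier_mat n n. f x = T * A" if "x \<in> ?P" for x
  proof -
    have "mat_convex {T * A |T. T \<in> carrier_mat n n}"
      unfolding mat_convex_def
    proof (intro ballI allI impI)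
      fix M M' and u w :: real
      assume "M \<in> {T * A |T. T \<in> carrier_mat n n}" "M' \<in> {T * A |T. T \<in> carrier_mat n n}"
      then obtain T T' where "T \<in> carrier_mat n n" "M = T * A" "T' \<in> carrier_mat n n" "M' = T' * A"
        by blast
      then show "u \<cdot>\<^sub>m M + w \<cdot>\<^sub>m M' \<in> {T * A |T. T \<in> carrier_mat n n}"
        using A by (intro CollectI exI[of _ "u \<cdot>\<^sub>m T + w \<cdot>\<^sub>m T'"])
          (simp add: add_mult_distrib_mat[of _ n n] mult_smult_assoc_mat[of _ n n])
    qed
    then have "?P \<subseteq> {x. f x \<in> {T * A |T. T \<in> carrier_mat n n}}"
      unfolding orbit_polytope_altdef using forbit D(1)
      by (intro hull_minimal convex_mat_affine_vimage[OF f]) auto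
    then show ?thesis
      using that by blast
  qed
  have "1\<^sub>m n \<in> representation_polytope G D"
    unfolding representation_polytope_def using D(3) G.one_closed by (intro hull_inc) force
  then obtain x where "x \<in> ?P" "f x = 1\<^sub>m n"
    using bij \<alpha>f by (metis (no_types, lifting) bij_betw_imp_surj_on imageE)
  then obtain T where T: "T \<in> carrier_mat n n" "T * A = 1\<^sub>m n"
    using multiple by metis
  then have AT: "A * T = 1\<^sub>m n"
    using A mat_mult_left_right_inverse by blast
  have entry: "(M * M') $$ (i, j) = (\<Sum>k<n. M $$ (i, k) * M' $$ (k, j))"
    if "M \<in> carrier_mat n n" "M' \<in> carrier_mat n n" "i < n" "j < n" for M M' :: "real mat" and i j
    using that by (auto simp: scalar_prod_def atLeast0LessThan intro!: sum.cong)
  have rel_mult: "(\<Sum>g\<in>carrier G. c g * (M g * M') $$ (i, j)) = 0"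
    if "\<And>g. g \<in> carrier G \<Longrightarrow> M g \<in> carrier_mat n n" "M' \<in> carrier_mat n n" "i < n" "j < n"
      "\<And>i j. i < n \<Longrightarrow> j < n \<Longrightarrow> (\<Sum>g\<in>carrier G. c g * M g $$ (i, j)) = 0"
    for c M i j and M' :: "real mat"
  proof -
    have "(\<Sum>g\<in>carrier G. c g * (M g * M') $$ (i, j))
      = (\<Sum>g\<in>carrier G. \<Sum>k<n. c g * M g $$ (i, k) * M' $$ (k, j))"
      using that(1-4) by (intro sum.cong refl) (simp add: entry sum_distrib_left mult.assoc)
    also have "\<dots> = (\<Sum>k<n. (\<Sum>g\<in>carrier G. c g * M g $$ (i, k)) * M' $$ (k, j))"
      by (subst sum.swap) (simp add: sum_distrib_right)
    also have "\<dots> = 0"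
      using that(3,5) by simp
    finally show ?thesis .
  qed
  have "\<exists>s. affine_map s \<and> (\<forall>g\<in>carrier G. s (\<phi> g v) = \<phi> (inv\<^bsub>G\<^esub> g) v)"
  proof (rule affine_extension_of_family[OF assms(2)])
    fix c :: "'g \<Rightarrow> real"
    assume c: "sum c (carrier G) = 0" "(\<Sum>g\<in>carrier G. c g *\<^sub>R \<phi> g v) = 0"
    have "(\<Sum>g\<in>carrier G. c g * (D g * A) $$ (i, j)) = 0" if "i < n" "j < n" for i j
      using affine_map_relation[OF mat_affine_map_entry[OF f that] c] by (simp add: forbit)
    note DA = this
    have "(\<Sum>g\<in>carrier G. c g * (D g * A * T) $$ (i, j)) = 0" if "i < n" "j < n" for i j
      by (rule rel_mult) (use that D(1) A T(1) DA in \<open>auto intro: mult_carrier_mat\<close>)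
    moreover have "D g * A * T = D g" if "g \<in> carrier G" for g
      using D(1)[OF that] A T(1) AT by (simp add: assoc_mult_mat[of _ n n _ n _ n])
    ultimately have "(\<Sum>g\<in>carrier G. c g * D g $$ (i, j)) = 0" if "i < n" "j < n" for i j
      using that by simp
    then have "(\<Sum>g\<in>carrier G. c g * D (inv\<^bsub>G\<^esub> g) $$ (i, j)) = 0" if "i < n" "j < n" for i j
      using that by (rule representation_inverse_relation[OF assms(1,2,4)])
    note D_inv = this
    have "(\<Sum>g\<in>carrier G. c g * (D (inv\<^bsub>G\<^esub> g) * A) $$ (i, j)) = 0" if "i < n" "j < n" for i j
      by (rule rel_mult) (use that D(1) A D_inv in auto)
    then have "(\<Sum>g\<in>carrier G. c g * f (\<phi> (inv\<^bsub>G\<^esub> g) v) $$ (i, j)) = 0" if "i < n" "j < n" for i j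
      using that by (simp add: forbit)
    \<comment> \<open>Inversion permutes the group, so the reindexed orbit spans the same polytope,
      on which \<open>f\<close> is known to be injective.\<close>
    moreover have "(\<lambda>g. \<phi> (inv\<^bsub>G\<^esub> g) v) ` carrier G = (\<lambda>g. \<phi> g v) ` carrier G"
      by (force simp: image_iff intro: bexI[of _ "inv\<^bsub>G\<^esub> _"])
    then have "convex hull ((\<lambda>g. \<phi> (inv\<^bsub>G\<^esub> g) v) ` carrier G) = ?P"
      by (simp add: orbit_polytope_altdef)
    ultimately show "(\<Sum>g\<in>carrier G. c g *\<^sub>R \<phi> (inv\<^bsub>G\<^esub> g) v) = 0"
      using c(1)
      by (intro relation_of_injective_affine_family[OF assms(2), where K = "{..<n} \<times> {..<n}"
            and F = "\<lambda>k x. f x $$ k"])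
        (auto intro!: inj mat_affine_map_entry[OF f])
  qed
  then obtain s where s: "affine_map s" "\<And>g. g \<in> carrier G \<Longrightarrow> s (\<phi> g v) = \<phi> (inv\<^bsub>G\<^esub> g) v"
    by blast
  have sP: "s x \<in> ?P" if "x \<in> ?P" for x
    using that s orbit_in_orbit_polytope[of _ G \<phi> v] unfolding orbit_polytope_altdef
    by (intro affine_map_hull_subset[OF s(1)]) auto
  \<comment> \<open>The affine map \<open>s\<close> composed with itself fixes the orbit and hence
    the polytope, so \<open>s\<close> is its own inverse there.\<close>
  have ss: "s (s x) = x" if "x \<in> ?P" for x
  proof (rule affine_map_eq_on_hull[OF affine_map_compose[OF s(1) s(1)], where g = "\<lambda>x. x"])
    show "x \<in> convex hull ((\<lambda>g. \<phi> g v) ` carrier G)"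
      using that by (simp add: orbit_polytope_altdef)
  qed (auto simp: s(2) affine_map_def)
  have "affine_symmetry ?P s"
    unfolding affine_symmetry_def using s(1) sP ss
    by (intro conjI bij_betw_byWitness[where f' = s]) auto
  then show ?thesis
    using s(2) by blast
qed

section \<open>Matrices of linear maps on a Euclidean space\<close>

text \<open>The enumeration \<open>e\<close> of \<open>Basis\<close> links the natural-number
  indices of \<open>real mat\<close> to the basis vectors of the type.\<close>

definition matrix_of_map :: "(nat \<Rightarrow> 'v::euclidean_space) \<Rightarrow> ('v \<Rightarrow> 'v) \<Rightarrow> real mat" where
  "matrix_of_map e F = mat DIM('v) DIM('v) (\<lambda>(i, j). F (e j) \<bullet> e i)"

lemma enumerated_basis_representation:
  fixes e :: "nat \<Rightarrow> 'v::euclidean_space"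
  assumes "bij_betw e {..<DIM('v)} Basis"
  shows "(\<Sum>i<DIM('v). (x \<bullet> e i) *\<^sub>R e i) = x"
  using sum.reindex_bij_betw[OF assms, of "\<lambda>b. (x \<bullet> b) *\<^sub>R b"] by (simp add: euclidean_representation)

text \<open>Expand \<open>x\<close> in the basis. Taking \<open>x = H (e j)\<close> and
  \<open>y = e i\<close> gives the entries of a matrix product; taking \<open>x = v\<close>
  evaluates a matrix at \<open>v\<close>.\<close>

lemma linear_inner_enumerated_basis:
  fixes e :: "nat \<Rightarrow> 'v::euclidean_space"
  assumes "bij_betw e {..<DIM('v)} Basis" "linear F"
  shows "(\<Sum>k<DIM('v). (F (e k) \<bullet> y) * (x \<bullet> e k)) = F x \<bullet> y"
proof -
  have "F x = (\<Sum>k<DIM('v). (x \<bullet> e k) *\<^sub>R F (e k))"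
    by (subst enumerated_basis_representation[OF assms(1), of x, symmetric])
      (simp add: linear_sum[OF assms(2)] linear_scale[OF assms(2)])
  then show ?thesis
    by (simp add: inner_sum_left mult.commute)
qed

lemma matrix_of_map_compose:
  fixes e :: "nat \<Rightarrow> 'v::euclidean_space"
  assumes "bij_betw e {..<DIM('v)} Basis" "linear F"
  shows "matrix_of_map e (\<lambda>x. F (H x)) = matrix_of_map e F * matrix_of_map e H"
  by (rule eq_matI)
    (auto simp: matrix_of_map_def scalar_prod_def atLeast0LessThan linear_inner_enumerated_basis[OF assms])

lemma matrix_of_map_id:
  fixes e :: "nat \<Rightarrow> 'v::euclidean_space"
  assumes e: "bij_betw e {..<DIM('v)} Basis"
  shows "matrix_of_map e (\<lambda>x. x) = 1\<^sub>m DIM('v)"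
proof (rule eq_matI)
  fix i j assume "i < dim_row (1\<^sub>m DIM('v) :: real mat)" "j < dim_col (1\<^sub>m DIM('v) :: real mat)"
  then have ij: "i < DIM('v)" "j < DIM('v)"
    by auto
  then have "e i \<in> Basis" "e j \<in> Basis" "e i = e j \<longleftrightarrow> i = j"
    using e by (auto simp: bij_betw_def inj_on_def)
  then show "matrix_of_map e (\<lambda>x. x) $$ (i, j) = 1\<^sub>m DIM('v) $$ (i, j)"
    using ij by (auto simp: matrix_of_map_def inner_Basis)
qed (auto simp: matrix_of_map_def)

section \<open>From the inverting symmetry to a representation polytope\<close>

text \<open>The identity on a basis of the span extends linearly without enlarging the range. The
  kernel of \<pi> is then a complement of the span.\<close>

lemma linear_projection_onto_span:
  fixes S :: "'v::real_vector set"
  obtains \<pi> where "linear \<pi>" "\<And>x. \<pi> x \<in> span S" "\<And>x. x \<in> span S \<Longrightarrow> \<pi> x = x"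
proof -
  obtain B where B: "B \<subseteq> S" "independent B" "S \<subseteq> span B"
    using real_vector.maximal_independent_subset by blast
  have span: "span B = span S"
    using B by (metis span_eq span_superset subset_trans)
  obtain \<pi> :: "'v \<Rightarrow> 'v" where \<pi>: "linear \<pi>" "\<And>x. x \<in> B \<Longrightarrow> \<pi> x = x" "range \<pi> = span B"
    using linear_independent_extend_subspace[OF B(2), of "\<lambda>x. x"] by auto
  have "\<pi> x = x" if "x \<in> span S" for x
    using linear_eq_on_span[OF \<pi>(1) linear_id, of B x] \<pi>(2) that span by auto
  with \<pi> show thesis
    using that span by blast
qed

text \<open>
  The representation is the given action on the span \<open>W\<close> of the orbit, extended by the identity on
  a complement of \<open>W\<close>. Conjugating with the symmetry turns the left translation
  \<open>g v \<mapsto> h\<^sup>-\<^sup>1 g v\<close> into the right translation \<open>g v \<mapsto> g h v\<close>, so an affine relation among the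
  points \<open>g v\<close> also holds among the points \<open>g h v\<close>, hence among the maps \<open>g\<close> on \<open>W\<close>.
\<close>

lemma equivalent_to_rep_polytope_if_inverse_symmetry:
  fixes \<phi> :: "'g \<Rightarrow> 'v::euclidean_space \<Rightarrow> 'v"
  assumes "group G" "finite (carrier G)" "linear_action G \<phi>"
    and sym: "affine_symmetry (orbit_polytope G \<phi> v) \<alpha>"
    and inv: "\<And>g. g \<in> carrier G \<Longrightarrow> \<alpha> (\<phi> g v) = \<phi> (inv\<^bsub>G\<^esub> g) v"
  shows "\<exists>n D. is_representation G n D \<and> affinely_equivalent_to_rep_polytope G \<phi> v n D"
proof -
  interpret G: group G by fact
  note \<phi> = linear_actionD[OF assms(3)]
  let ?P = "orbit_polytope G \<phi> v"
  let ?O = "(\<lambda>g. \<phi> g v) ` carrier G"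
  obtain s where s: "affine_map s" and "\<And>x. x \<in> ?P \<Longrightarrow> \<alpha> x = s x"
    using sym unfolding affine_symmetry_def by blast
  then have s_inv: "s (\<phi> g v) = \<phi> (inv\<^bsub>G\<^esub> g) v" if "g \<in> carrier G" for g
    using inv[OF that] orbit_in_orbit_polytope[OF that] by metis
  have right_translate: "(\<Sum>g\<in>carrier G. c g *\<^sub>R \<phi> g (\<phi> h v)) = 0"
    if c: "sum c (carrier G) = 0" "(\<Sum>g\<in>carrier G. c g *\<^sub>R \<phi> g v) = 0" and h: "h \<in> carrier G" for c h
  proof -
    interpret h: linear "\<phi> (inv\<^bsub>G\<^esub> h)"
      using h by (intro \<phi>(1)) simp
    have "(\<Sum>g\<in>carrier G. c g *\<^sub>R s (\<phi> g v)) = 0"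
      using c by (rule affine_map_relation[OF s])
    then have "\<phi> (inv\<^bsub>G\<^esub> h) (\<Sum>g\<in>carrier G. c g *\<^sub>R \<phi> (inv\<^bsub>G\<^esub> g) v) = 0"
      by (simp add: s_inv h.zero)
    then have "(\<Sum>g\<in>carrier G. c g *\<^sub>R \<phi> (inv\<^bsub>G\<^esub> (g \<otimes>\<^bsub>G\<^esub> h)) v) = 0"
      using h by (simp add: h.sum h.scale \<phi>(2) G.inv_mult_group)
    then have "(\<Sum>g\<in>carrier G. c g *\<^sub>R s (\<phi> (inv\<^bsub>G\<^esub> (g \<otimes>\<^bsub>G\<^esub> h)) v)) = 0"
      using c(1) by (intro affine_map_relation[OF s])
    then show ?thesis
      using h by (simp add: s_inv flip: \<phi>(2))
  qed
  obtain \<pi> where \<pi>: "linear \<pi>" "\<And>x. \<pi> x \<in> span ?O" "\<And>x. x \<in> span ?O \<Longrightarrow> \<pi> x = x"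
    using linear_projection_onto_span by metis
  have span_invariant: "\<phi> g x \<in> span ?O" if g: "g \<in> carrier G" and "x \<in> span ?O" for g x
  proof -
    have "\<phi> g ` ?O \<subseteq> ?O"
      using g by (auto simp flip: \<phi>(2))
    then have "span (\<phi> g ` ?O) \<subseteq> span ?O"
      by (rule span_mono)
    then show ?thesis
      using that by (auto simp: linear_span_image[OF \<phi>(1)[OF g]])
  qed
  \<comment> \<open>In the splitting of \<open>x\<close> into \<open>\<pi> x\<close> and
    \<open>x - \<pi> x\<close>, only the first part is moved by \<open>g\<close>.\<close>
  define \<psi> where "\<psi> g x = x + \<phi> g (\<pi> x) - \<pi> x" for g x
  have \<psi>_linear: "linear (\<psi> g)" if "g \<in> carrier G" for g
    unfolding \<psi>_def
    using linear_compose[OF \<pi>(1) \<phi>(1)[OF that]] \<pi>(1)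
    by (intro linear_compose_sub linear_compose_add) (auto simp: o_def linear_ident)
  have \<psi>_mult: "\<psi> (g \<otimes>\<^bsub>G\<^esub> h) x = \<psi> g (\<psi> h x)" if "g \<in> carrier G" "h \<in> carrier G" for g h x
  proof -
    have "\<pi> (\<psi> h x) = \<phi> h (\<pi> x)"
      using \<pi>(2) span_invariant[OF that(2)]
      by (simp add: \<psi>_def linear_add[OF \<pi>(1)] linear_diff[OF \<pi>(1)] \<pi>(3))
    then show ?thesis
      using that by (simp add: \<psi>_def[of g] \<psi>_def[of "g \<otimes>\<^bsub>G\<^esub> h"] \<phi>(2)) (simp add: \<psi>_def)
  qed
  have v: "\<pi> v = v"
    using \<phi>(3)[of v] by (intro \<pi>(3) span_base) (force intro: image_eqI[of _ _ "\<one>\<^bsub>G\<^esub>"])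
  have \<psi>_v: "\<psi> g v = \<phi> g v" for g
    by (simp add: \<psi>_def v)
  \<comment> \<open>On the span, the combination of the maps vanishes because it kills every orbit
    point. On the complement each map is the identity, so the coefficient sum 0 is what makes the
    combination vanish.\<close>
  have \<psi>_relation: "(\<Sum>g\<in>carrier G. c g *\<^sub>R \<psi> g x) = 0"
    if c: "sum c (carrier G) = 0" "(\<Sum>g\<in>carrier G. c g *\<^sub>R \<phi> g v) = 0" for c x
  proof -
    have "linear (\<lambda>y. \<Sum>g\<in>carrier G. c g *\<^sub>R \<phi> g y)"
      using \<phi>(1) by (intro linear_compose_sum linear_compose_scale_right ballI)
    then have "(\<Sum>g\<in>carrier G. c g *\<^sub>R \<phi> g (\<pi> x)) = 0"
      by (rule linear_eq_0_on_span[OF _ _ \<pi>(2)]) (auto simp: right_translate[OF c])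
    then show ?thesis
      using c(1) by (simp add: \<psi>_def scaleR_right_distrib scaleR_right_diff_distrib sum.distrib
          sum_subtractf flip: scaleR_left.sum)
  qed
  obtain e :: "nat \<Rightarrow> 'v" where e: "bij_betw e {..<DIM('v)} Basis"
    using ex_bij_betw_nat_finite[OF finite_Basis] by (metis atLeast0LessThan)
  define n where "n = DIM('v)"
  define D where "D g = matrix_of_map e (\<psi> g)" for g
  have D_carrier: "D g \<in> carrier_mat n n" for g
    by (simp add: D_def matrix_of_map_def n_def)
  have rep: "is_representation G n D"
  proof (rule is_representationI[OF assms(1)])
    show "D (g \<otimes>\<^bsub>G\<^esub> h) = D g * D h" if "g \<in> carrier G" "h \<in> carrier G" for g h
    proof -
      have "\<psi> (g \<otimes>\<^bsub>G\<^esub> h) = (\<lambda>x. \<psi> g (\<psi> h x))"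
        by (rule ext) (rule \<psi>_mult[OF that])
      then show ?thesis
        by (simp only: D_def) (rule matrix_of_map_compose[OF e \<psi>_linear[OF that(1)]])
    qed
    have "\<psi> \<one>\<^bsub>G\<^esub> = (\<lambda>x. x)"
      by (rule ext) (simp add: \<psi>_def \<phi>(3))
    then show "D \<one>\<^bsub>G\<^esub> = 1\<^sub>m n"
      by (simp add: D_def n_def matrix_of_map_id[OF e])
  qed (rule D_carrier)
  \<comment> \<open>Every matrix entry of \<open>\<psi> g\<close> is an affine function of
    \<open>\<phi> g v\<close>; collecting these functions gives the map \<open>f\<close> with
    \<open>f (\<phi> g v) = D g\<close>.\<close>
  have "\<exists>F. affine_map F \<and> (\<forall>g\<in>carrier G. F (\<phi> g v) = \<psi> g (e j) \<bullet> e i)" for i j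
  proof (rule affine_extension_of_family[OF assms(2)])
    fix c assume "sum c (carrier G) = 0" "(\<Sum>g\<in>carrier G. c g *\<^sub>R \<phi> g v) = 0"
    then have "(\<Sum>g\<in>carrier G. c g *\<^sub>R \<psi> g (e j)) \<bullet> e i = 0"
      by (simp add: \<psi>_relation)
    then show "(\<Sum>g\<in>carrier G. c g *\<^sub>R (\<psi> g (e j) \<bullet> e i)) = 0"
      by (simp add: inner_sum_left)
  qed
  then have "\<forall>i j. \<exists>F. affine_map F \<and> (\<forall>g\<in>carrier G. F (\<phi> g v) = \<psi> g (e j) \<bullet> e i)"
    by blast
  then obtain F where F: "\<And>i j. affine_map (F i j)"
    and F_orbit: "\<And>i j g. g \<in> carrier G \<Longrightarrow> F i j (\<phi> g v) = \<psi> g (e j) \<bullet> e i"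
    unfolding choice_iff by blast
  define f where "f x = mat n n (\<lambda>(i, j). F i j x)" for x
  have f: "mat_affine_map n f"
    using F unfolding mat_affine_map_def affine_map_def
    by (auto simp: f_def intro!: eq_matI)
  have f_orbit: "f (\<phi> g v) = D g" if "g \<in> carrier G" for g
    using that by (intro eq_matI) (auto simp: f_def D_def matrix_of_map_def n_def F_orbit)
  \<comment> \<open>\<open>R x\<close> is the matrix \<open>f x\<close> applied to \<open>v\<close>.
    Since \<open>\<psi> g v = \<phi> g v\<close>, it recovers each orbit point from its matrix and,
    being affine, each point of the polytope; hence \<open>f\<close> is injective there.\<close>
  define R where "R x = (\<Sum>i<n. \<Sum>j<n. (F i j x * (v \<bullet> e j)) *\<^sub>R e i)" for x
  have R_affine: "affine_map R"
    using F unfolding affine_map_def R_def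
    by (simp add: algebra_simps sum.distrib scaleR_sum_right)
  have R_orbit: "R (\<phi> g v) = \<phi> g v" if "g \<in> carrier G" for g
    using linear_inner_enumerated_basis[OF e \<psi>_linear[OF that], of _ v]
    by (simp add: R_def F_orbit that n_def enumerated_basis_representation[OF e] \<psi>_v
        flip: scaleR_left.sum)
  have R: "R x = x" if "x \<in> ?P" for x
    by (rule affine_map_eq_on_hull[OF R_affine linear_imp_affine_map[OF linear_ident]])
      (use that R_orbit in \<open>auto simp: orbit_polytope_altdef\<close>)
  have "R x = R y" if "f x = f y" for x y
  proof -
    have "F i j x = F i j y" if "i < n" "j < n" for i j
      using arg_cong[OF \<open>f x = f y\<close>, of "\<lambda>M. M $$ (i, j)"] that by (simp add: f_def)
    then show ?thesis
      by (simp add: R_def)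
  qed
  then have inj: "inj_on f ?P"
    by (metis R inj_onI)
  have D_set: "{D g |g. g \<in> carrier G} = D ` carrier G"
    by auto
  have "?P \<subseteq> {x. f x \<in> representation_polytope G D}"
    unfolding orbit_polytope_altdef representation_polytope_def D_set
    by (intro hull_minimal convex_mat_affine_vimage[OF f] mat_convex_mat_convex_hull)
      (auto simp: f_orbit intro: hull_inc)
  moreover have "representation_polytope G D \<subseteq> f ` ?P"
    unfolding representation_polytope_def D_set
  proof (rule hull_minimal)
    show "D ` carrier G \<subseteq> f ` ?P"
      using f_orbit orbit_in_orbit_polytope by (metis image_eqI image_subsetI)
    have "convex ?P"
      by (simp add: orbit_polytope_altdef)
    then show "mat_convex (f ` ?P)"
      unfolding mat_convex_def
    proof (intro ballI allI impI)
      fix M M' and u w :: real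
      assume "M \<in> f ` ?P" "M' \<in> f ` ?P" "0 \<le> u" "0 \<le> w" "u + w = 1"
      then obtain x y where xy: "x \<in> ?P" "M = f x" "y \<in> ?P" "M' = f y"
        by blast
      then have "u *\<^sub>R x + w *\<^sub>R y \<in> ?P"
        using \<open>convex ?P\<close> \<open>0 \<le> u\<close> \<open>0 \<le> w\<close> \<open>u + w = 1\<close> by (intro convexD)
      moreover have "u \<cdot>\<^sub>m M + w \<cdot>\<^sub>m M' = f (u *\<^sub>R x + w *\<^sub>R y)"
        using f xy \<open>u + w = 1\<close> by (simp add: mat_affine_map_def)
      ultimately show "u \<cdot>\<^sub>m M + w \<cdot>\<^sub>m M' \<in> f ` ?P"
        by blast
    qed
  qed
  ultimately have bij: "bij_betw f ?P (representation_polytope G D)"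
    using inj by (auto simp: bij_betw_def)
  have "f (\<phi> g x) = D g * f x" if g: "g \<in> carrier G" and x: "x \<in> ?P" for g x
  proof -
    \<comment> \<open>Both sides are affine in \<open>x\<close>, so equivariance need only be
      checked on the orbit, where it is multiplicativity of \<open>D\<close>.\<close>
    have "convex {x. f (\<phi> g x) = D g * f x}"
      using f linear_imp_affine_map[OF \<phi>(1)[OF g]] D_carrier[of g]
      unfolding convex_def mat_affine_map_def affine_map_def
      by (auto simp: mult_add_distrib_mat[of _ n n _ n] mult_smult_distrib[of _ n n _ n])
    moreover have "f (\<phi> g (\<phi> h v)) = D g * f (\<phi> h v)" if "h \<in> carrier G" for h
      using g that is_representationD(2)[OF assms(1) rep] by (simp add: f_orbit flip: \<phi>(2))
    ultimately have "?P \<subseteq> {x. f (\<phi> g x) = D g * f x}"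
      unfolding orbit_polytope_altdef by (intro hull_minimal) auto
    then show ?thesis
      using x by blast
  qed
  then show ?thesis
    using rep bij f unfolding affinely_equivalent_to_rep_polytope_def by blast
qed

theorem theorem6:
  fixes G :: "('g, 'b) monoid_scheme"
    and \<phi> :: "'g \<Rightarrow> real ^ 'd \<Rightarrow> real ^ 'd"
    and v :: "real ^ 'd"
  assumes "group G" and "finite (carrier G)" and "linear_action G \<phi>"
  shows "(\<exists>n D. is_representation G n D \<and> affinely_equivalent_to_rep_polytope G \<phi> v n D) \<longleftrightarrow>
    (\<exists>\<alpha>. affine_symmetry (orbit_polytope G \<phi> v) \<alpha> \<and>
         (\<forall>g\<in>carrier G. \<alpha> (\<phi> g v) = \<phi> (inv\<^bsub>G\<^esub> g) v))"
  using inverse_symmetry_if_equivalent_to_rep_polytope[OF assms]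
    equivalent_to_rep_polytope_if_inverse_symmetry[OF assms] by metis

end
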